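(* Let $B\in\mathbb{Q}^{n\times m}$ have rank $n$ ($m\ge n$), let $P,R_w\in\mathbb{R}^{n\times n}$ and $R_u\in\mathbb{R}^{m\times m}$ be symmetric positive definite, and let $\mathcal W=\{w\in\mathbb{R}^n: w^TR_ww\le1\}$, $\mathcal U=\{u\in\mathbb{R}^m: u^TR_uu\le1\}$. Let $H$ and $\Phi=H^TR_uH$ be the matrices defined in the context, let $k\in\mathbb{R}$, $\xi\ge1$, $\Sigma_0(\xi)=\{x\in\mathbb{R}^n: x^TPx\le\xi\}$ and $\Pi=\{x\in\mathbb{R}^n: x^TPx\le1\}$. If $$k^2\ge\lambda_{max}(R_w^{-1}P)\qquad\text{and}\qquad k^2\,\xi\,\lambda_{max}(P^{-1}\Phi)\le1,$$ then for the system $\dot x(t)=Bu(t)-w(t)$ with $w(t)\in\mathcal W$ and the control constraint $u(t)\in\mathcal U$, the linear state feedback $u=-kHx$ drives the state $x(t)$ from any initial value $x(0)\in\Sigma_0(\xi)$ to the target set $\Pi$ (with $u(t)=-kHx(t)\in\mathcal U$ for all $t\ge0$).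
   Context: $\lambda_{max}(Z)$ denotes the maximum eigenvalue of $Z$. "The feedback drives the state to $\Pi$" means: for every (measurable) demand $w:[0,\infty)\to\mathcal W$, the closed-loop trajectory converges to $\Pi$, i.e. $\mathrm{dist}(x(t),\Pi)\to0$ as $t\to\infty$. Definition of $H,\Phi$. Order the columns of $B$ (and correspondingly the components of $u$, hence the rows and columns of $R_u$) so that $B=[\mathcal B\,|\,N]$ with $\mathcal B\in\mathbb{R}^{n\times n}$ invertible and $N\in\mathbb{R}^{n\times(m-n)}$ the remaining columns. Let $$M=\left([-N^T\mathcal B^{-T}\,|\,I]\,R_u\begin{bmatrix}-\mathcal B^{-1}N\\ I\end{bmatrix}\right)^{-1}[-N^T\mathcal B^{-T}\,|\,I]\,R_u\begin{bmatrix}\mathcal B^{-1}\\ 0\end{bmatrix},$$ where $I$ is the $(m-n)\times(m-n)$ identity and $0$ the $(m-n)\times n$ zero matrix, and $$H=\begin{bmatrix}\mathcal B^{-1}+\mathcal B^{-1}NM\\ -M\end{bmatrix}\in\mathbb{R}^{m\times n},\qquad \Phi=H^TR_uH.$$ Then $BH=I$. If $m=n$, then $N$ and $M$ are empty and $H=B^{-1}$.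
   Formalization: The formal theorem assumes k > 0 instead of k real; for k < 0 the claim is false (n = m = 1, all matrices 1, ξ = 1, k = -1, w = 0, x(0) = 1 gives x = e^t), and k = 0 is already excluded by the first inequality. *)

theory Defs
  imports
    "HOL-Analysis.Analysis"
    "Jordan_Normal_Form.Gauss_Jordan_Elimination"
    "Jordan_Normal_Form.DL_Rank"
    "Jordan_Normal_Form.Spectral_Radius"
begin

text \<open>
  Vectors and matrices are those of \<^theory>\<open>Jordan_Normal_Form.Matrix\<close>, whose dimensions are
  natural numbers: the construction below needs blocks with \<open>m - n\<close> rows or columns, and these
  blocks are empty when \<open>m = n\<close>. HOL-Analysis has a type \<open>vec\<close> and notation of its own, so
  clashing names are qualified and vector operations are written in prefix form.
\<close>

definition pos_def_mat :: "nat \<Rightarrow> real mat \<Rightarrow> bool" where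
  "pos_def_mat n A \<longleftrightarrow> A \<in> carrier_mat n n \<and> transpose_mat A = A \<and>
     (\<forall>v \<in> carrier_vec n. v \<noteq> 0\<^sub>v n \<longrightarrow> scalar_prod v (A *\<^sub>v v) > 0)"

definition ellipsoid :: "nat \<Rightarrow> real mat \<Rightarrow> real \<Rightarrow> real Matrix.vec set" where
  "ellipsoid n Q c = {x \<in> carrier_vec n. scalar_prod x (Q *\<^sub>v x) \<le> c}"

text \<open>Only applied to invertible matrices; the inverse of the 0 by 0 matrix is itself.\<close>

definition minv :: "real mat \<Rightarrow> real mat" where
  "minv A = the (mat_inverse A)"

text \<open>
  \<^const>\<open>spectrum\<close> of a real matrix is the set of its real eigenvalues. This map is only
  applied to products \<open>S T\<close> with \<open>S\<close> and \<open>T\<close> symmetric positive definite,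
  and all eigenvalues of such a product are real.
\<close>

definition lambda_max :: "real mat \<Rightarrow> real" where
  "lambda_max Z = Max (spectrum Z)"

definition append_cols :: "real mat \<Rightarrow> real mat \<Rightarrow> real mat" (infixr "@\<^sub>c" 65) where
  "A @\<^sub>c C = four_block_mat A C (0\<^sub>m 0 (dim_col A)) (0\<^sub>m 0 (dim_col C))"

text \<open>Position \<open>j\<close> of the new order holds the component with old index \<open>p j\<close>.\<close>

definition reorder_cols :: "(nat \<Rightarrow> nat) \<Rightarrow> real mat \<Rightarrow> real mat" where
  "reorder_cols p A = Matrix.mat (dim_row A) (dim_col A) (\<lambda>(i, j). A $$ (i, p j))"

definition reorder_rows :: "(nat \<Rightarrow> nat) \<Rightarrow> real mat \<Rightarrow> real mat" where
  "reorder_rows p A = Matrix.mat (dim_row A) (dim_col A) (\<lambda>(i, j). A $$ (p i, j))"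

text \<open>
  \<open>M\<close> and \<open>H\<close> for an input matrix of the form \<open>Bb @\<^sub>c N\<close>, with \<open>Bb\<close> square and invertible and
  the input weight \<open>R\<close> listed in the same order of the input components.
\<close>

definition M_mat :: "real mat \<Rightarrow> real mat \<Rightarrow> real mat \<Rightarrow> real mat" where
  "M_mat Bb N R =
    (let n = dim_col Bb; l = dim_col N;
         L = (- (transpose_mat N * transpose_mat (minv Bb))) @\<^sub>c 1\<^sub>m l
     in minv (L * R * ((- (minv Bb * N)) @\<^sub>r 1\<^sub>m l)) * (L * R * (minv Bb @\<^sub>r 0\<^sub>m l n)))"

definition H_ordered :: "real mat \<Rightarrow> real mat \<Rightarrow> real mat \<Rightarrow> real mat" where
  "H_ordered Bb N R = (minv Bb + minv Bb * N * M_mat Bb N R) @\<^sub>r (- M_mat Bb N R)"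

text \<open>
  The same matrix when \<open>Bb @\<^sub>c N\<close> is the input matrix with its columns reordered by \<open>p\<close>, while
  \<open>Ru\<close> is given in the original order: \<open>Ru\<close> is reordered accordingly, and the rows of the
  result are put back into the original order, so that \<open>H\<close> fits the original input matrix.
\<close>

definition H_mat :: "(nat \<Rightarrow> nat) \<Rightarrow> real mat \<Rightarrow> real mat \<Rightarrow> real mat \<Rightarrow> real mat" where
  "H_mat p Bb N Ru =
     reorder_rows (inv_into UNIV p) (H_ordered Bb N (reorder_rows p (reorder_cols p Ru)))"

definition Phi_mat :: "real mat \<Rightarrow> real mat \<Rightarrow> real mat" where
  "Phi_mat H Ru = transpose_mat H * Ru * H"

definition vdist :: "real Matrix.vec \<Rightarrow> real Matrix.vec \<Rightarrow> real" where
  "vdist x y = sqrt (scalar_prod (x - y) (x - y))"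

definition vsetdist :: "real Matrix.vec \<Rightarrow> real Matrix.vec set \<Rightarrow> real" where
  "vsetdist x S = (INF y\<in>S. vdist x y)"

definition demand :: "nat \<Rightarrow> real Matrix.vec set \<Rightarrow> (real \<Rightarrow> real Matrix.vec) \<Rightarrow> bool" where
  "demand n W w \<longleftrightarrow> (\<forall>t\<ge>0. w t \<in> W) \<and>
     (\<forall>i<n. (\<lambda>t. vec_index (w t) i) \<in> borel_measurable (lebesgue_on {0..}))"

text \<open>
  \<open>x\<close> solves \<open>x' = B u - w\<close> on \<open>[0, \<infinity>)\<close>. As \<open>w\<close> is only measurable, solutions are understood in
  the sense of Caratheodory (locally absolutely continuous, equation valid almost everywhere),
  which is expressed by the integral equation.
\<close>

definition trajectory :: "nat \<Rightarrow> real mat \<Rightarrow> (real \<Rightarrow> real Matrix.vec) \<Rightarrow>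
    (real \<Rightarrow> real Matrix.vec) \<Rightarrow> (real \<Rightarrow> real Matrix.vec) \<Rightarrow> bool" where
  "trajectory n B u w x \<longleftrightarrow> (\<forall>t\<ge>0. x t \<in> carrier_vec n) \<and>
     (\<forall>t\<ge>0. \<forall>i<n.
        (\<lambda>s. vec_index (B *\<^sub>v u s - w s) i) absolutely_integrable_on {0..t} \<and>
        vec_index (x t) i =
          vec_index (x 0) i + integral {0..t} (\<lambda>s. vec_index (B *\<^sub>v u s - w s) i))"

end

theory Submission
  imports Defs
begin

text \<open>
  Since \<open>B H = I\<close>, the closed loop is \<open>x' = - k x - w\<close>. Write \<open>|v|\<close> for the norm given by \<open>P\<close>.
  The first eigenvalue condition says \<open>|w| \<le> k\<close>, so for fixed \<open>T\<close> the scalar function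
  \<open>X(t) = \<langle>x(T), P x(t)\<rangle>\<close> satisfies \<open>X' \<le> k (|x(T)| - X)\<close>; comparison on \<open>[0, T]\<close> and division by
  \<open>|x(T)|\<close> give \<open>|x(T)| \<le> 1 + e\<^sup>-\<^sup>k\<^sup>T (|x(0)| - 1)\<close>. Hence \<open>|x|\<close> never exceeds \<open>\<surd>\<xi>\<close>, which together
  with the second eigenvalue condition is the control constraint, and the distance to the unit
  ball of \<open>|\<cdot>|\<close> decays exponentially.
\<close>

section \<open>Rayleigh quotients\<close>

abbreviation qform :: "real mat \<Rightarrow> real Matrix.vec \<Rightarrow> real" where
  "qform A x \<equiv> scalar_prod x (A *\<^sub>v x)"

section \<open>Inverses and positive definite matrices\<close>

text \<open>\<open>minv\<close> takes \<open>the\<close> of an option, so what matters is that the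
  option is not \<open>None\<close>: an invertible matrix is a unit of the matrix ring, and on units
  \<open>mat_inverse\<close> succeeds.\<close>

lemma minv_inverse:
  assumes "A \<in> carrier_mat n n" and "invertible_mat A"
  shows "minv A \<in> carrier_mat n n" "A * minv A = 1\<^sub>m n" "minv A * A = 1\<^sub>m n"
proof -
  obtain C where C: "inverts_mat A C" "inverts_mat C A"
    using assms(2) by (auto simp: invertible_mat_def)
  have AC: "A * C = 1\<^sub>m n"
    using C(1) assms(1) by (auto simp: inverts_mat_def)
  have CA: "C * A = 1\<^sub>m (dim_row C)"
    using C(2) by (auto simp: inverts_mat_def)
  \<comment> \<open>\<open>inverts_mat\<close> says nothing directly about the dimensions of
    \<open>C\<close>; they are read off from the two product identities.\<close>
  have "dim_col C = n" using arg_cong[OF AC, of dim_col] by simp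
  moreover have "dim_row C = n" using arg_cong[OF CA, of dim_col] assms(1) by simp
  ultimately have cC: "C \<in> carrier_mat n n" by auto
  have "A \<in> Units (ring_mat TYPE(real) n ())"
    using assms(1) cC AC CA \<open>dim_row C = n\<close> by (auto simp: Units_def ring_mat_def)
  then obtain D where "mat_inverse A = Some D"
    using mat_inverse(1)[OF assms(1), where b = "()"] by blast
  then show "minv A \<in> carrier_mat n n" "A * minv A = 1\<^sub>m n" "minv A * A = 1\<^sub>m n"
    using mat_inverse(2)[OF assms(1)] by (auto simp: minv_def)
qed

lemma pos_def_matD:
  assumes "pos_def_mat n A"
  shows "A \<in> carrier_mat n n" "transpose_mat A = A"
    "\<And>v. v \<in> carrier_vec n \<Longrightarrow> v \<noteq> 0\<^sub>v n \<Longrightarrow> qform A v > 0"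
    "\<And>v. v \<in> carrier_vec n \<Longrightarrow> qform A v \<ge> 0"
proof -
  show c: "A \<in> carrier_mat n n" "transpose_mat A = A"
    and pos: "\<And>v. v \<in> carrier_vec n \<Longrightarrow> v \<noteq> 0\<^sub>v n \<Longrightarrow> qform A v > 0"
    using assms by (auto simp: pos_def_mat_def)
  fix v :: "real Matrix.vec" assume v: "v \<in> carrier_vec n"
  show "qform A v \<ge> 0"
  proof (cases "v = 0\<^sub>v n")
    case True
    with c(1) v show ?thesis by simp
  next
    case False
    with pos[OF v] show ?thesis by simp
  qed
qed

text \<open>A vanishing determinant would give a nonzero kernel vector, on which the form would be
  0.\<close>

lemma pos_def_invertible:
  assumes "pos_def_mat n A"
  shows "invertible_mat A"
proof -
  note A = pos_def_matD[OF assms]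
  have "Determinant.det A \<noteq> 0"
  proof
    assume "Determinant.det A = 0"
    then obtain v where v: "v \<in> carrier_vec n" "v \<noteq> 0\<^sub>v n" "A *\<^sub>v v = 0\<^sub>v n"
      using det_0_iff_vec_prod_zero[OF A(1)] by auto
    then show False using A(3)[OF v(1,2)] by simp
  qed
  then obtain C where C: "C \<in> carrier_mat n n" "C * A = 1\<^sub>m n" "A * C = 1\<^sub>m n"
    using det_non_zero_imp_unit[OF A(1), of "()"] by (auto simp: Units_def ring_mat_def)
  then show ?thesis
    using A(1) by (auto simp: invertible_mat_def inverts_mat_def)
qed

section \<open>Semidefinite quadratic forms\<close>

lemma scalar_prod_symmetric:
  assumes "A \<in> carrier_mat n n" "transpose_mat A = (A :: real mat)"
    and "x \<in> carrier_vec n" "y \<in> carrier_vec n"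
  shows "scalar_prod x (A *\<^sub>v y) = scalar_prod y (A *\<^sub>v x)"
proof -
  have "scalar_prod (A *\<^sub>v y) x = scalar_prod y (A *\<^sub>v x)"
    using transpose_vec_mult_scalar[OF assms(1,3,4)] assms(2) by simp
  moreover have "scalar_prod (A *\<^sub>v y) x = scalar_prod x (A *\<^sub>v y)"
    by (rule comm_scalar_prod[of _ n]) (use assms in auto)
  ultimately show ?thesis by simp
qed

lemma qform_add_smult:
  assumes A: "A \<in> carrier_mat n n" "transpose_mat A = (A :: real mat)"
    and x: "x \<in> carrier_vec n" and y: "y \<in> carrier_vec n"
  shows "qform A (x + t \<cdot>\<^sub>v y) = qform A x + 2 * t * scalar_prod x (A *\<^sub>v y) + t\<^sup>2 * qform A y"
proof -
  have "A *\<^sub>v (x + t \<cdot>\<^sub>v y) = A *\<^sub>v x + t \<cdot>\<^sub>v (A *\<^sub>v y)"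
    using A x y by (simp add: mult_add_distrib_mat_vec[of _ n n] mult_mat_vec[of _ n n])
  moreover have Ac: "A *\<^sub>v x \<in> carrier_vec n" "A *\<^sub>v y \<in> carrier_vec n"
    using A x y by auto
  moreover have "scalar_prod (x + t \<cdot>\<^sub>v y) (A *\<^sub>v x + t \<cdot>\<^sub>v (A *\<^sub>v y)) =
      qform A x + t * scalar_prod x (A *\<^sub>v y) + (t * scalar_prod y (A *\<^sub>v x) + t * (t * qform A y))"
    using x y Ac
    by (simp add: add_scalar_prod_distrib[of _ n] scalar_prod_add_distrib[of _ n] distrib_left)
  ultimately show ?thesis
    using scalar_prod_symmetric[OF A x y] by (simp add: power2_eq_square)
qed

lemma psd_cauchy_schwarz:
  assumes A: "A \<in> carrier_mat n n" "transpose_mat A = A"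
    and psd: "\<And>v. v \<in> carrier_vec n \<Longrightarrow> qform A v \<ge> 0"
    and x: "x \<in> carrier_vec n" and y: "y \<in> carrier_vec n"
  shows "(scalar_prod x (A *\<^sub>v y))\<^sup>2 \<le> qform A x * qform A y"
proof -
  define a b c where "a = qform A x" and "b = scalar_prod x (A *\<^sub>v y)" and "c = qform A y"
  have q: "a + 2 * t * b + t\<^sup>2 * c \<ge> 0" for t
    using psd[of "x + t \<cdot>\<^sub>v y"] qform_add_smult[OF A x y, of t] x y
    by (simp add: a_def b_def c_def)
  have "b\<^sup>2 \<le> a * c"
  proof (cases "c = 0")
    case True
    have "b = 0"
    proof (rule ccontr)
      assume "b \<noteq> 0"
      \<comment> \<open>With \<open>c = 0\<close> the polynomial is affine, and at this
        \<open>t\<close> its value would be -1.\<close>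
      then have "2 * (- (a + 1) / (2 * b)) * b = - (a + 1)" by simp
      with q[of "- (a + 1) / (2 * b)"] True show False by simp
    qed
    with True show ?thesis by simp
  next
    case False
    with psd[OF y] have c: "c > 0" by (simp add: c_def)
    \<comment> \<open>\<open>t = - b / c\<close> is the vertex of the parabola.\<close>
    then have "a + 2 * (- b / c) * b + (- b / c)\<^sup>2 * c = a - b\<^sup>2 / c"
      by (simp add: field_simps power2_eq_square)
    with q[of "- b / c"] have "b\<^sup>2 / c \<le> a" by simp
    with c show ?thesis by (simp add: field_simps)
  qed
  then show ?thesis by (simp add: a_def b_def c_def)
qed

text \<open>Cauchy-Schwarz for the pair \<open>A v\<close>, \<open>v\<close> bounds the squared
  Euclidean norm of \<open>A v\<close> by 0.\<close>

lemma psd_kernel: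
  assumes A: "A \<in> carrier_mat n n" "transpose_mat A = A"
    and psd: "\<And>v. v \<in> carrier_vec n \<Longrightarrow> qform A v \<ge> 0"
    and v: "v \<in> carrier_vec n" "qform A v = 0"
  shows "A *\<^sub>v v = 0\<^sub>v n"
proof -
  have Av: "A *\<^sub>v v \<in> carrier_vec n" using A v by auto
  have "(scalar_prod (A *\<^sub>v v) (A *\<^sub>v v))\<^sup>2 \<le> 0"
    using psd_cauchy_schwarz[OF A psd Av v(1)] v(2) by simp
  then have "scalar_prod (A *\<^sub>v v) (A *\<^sub>v v) = 0" by simp
  then have z: "\<forall>i\<in>{0..<dim_vec (A *\<^sub>v v)}. vec_index (A *\<^sub>v v) i * vec_index (A *\<^sub>v v) i = 0"
    unfolding scalar_prod_def by (subst (asm) sum_nonneg_eq_0_iff) simp_all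
  show ?thesis
  proof (rule eq_vecI)
    fix i assume "i < dim_vec (0\<^sub>v n :: real Matrix.vec)"
    with z Av show "vec_index (A *\<^sub>v v) i = vec_index (0\<^sub>v n) i"
      by (metis atLeastLessThan_iff carrier_vecD index_zero_vec mult_eq_0_iff zero_le)
  qed (use A(1) in simp)
qed

section \<open>The maximum of the generalised Rayleigh quotient\<close>

text \<open>Topology is done on coordinate functions \<open>f :: nat \<Rightarrow> real\<close> with
  the product topology. There the form is a polynomial in finitely many coordinates, each of which
  is continuous.\<close>

lemma continuous_on_qform_vec:
  assumes "A \<in> carrier_mat n n"
  shows "continuous_on UNIV (\<lambda>f. qform A (Matrix.vec n f))"
proof -
  have "qform A (Matrix.vec n f) = (\<Sum>i<n. f i * (\<Sum>j<n. A $$ (i, j) * f j))" for f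
    using assms by (simp add: scalar_prod_def atLeast0LessThan)
  moreover have "continuous_on UNIV (\<lambda>f. \<Sum>i<n. f i * (\<Sum>j<n. A $$ (i, j) * f j))"
    by (intro continuous_on_sum continuous_on_mult continuous_on_const
        continuous_on_product_coordinates)
  ultimately show ?thesis by simp
qed

text \<open>This is the unit sphere of the maximum norm in coordinate functions. Coordinates from
  \<open>n\<close> on are pinned to 0, so that the surrounding cube is compact by Tychonoff;
  choosing the index \<open>j\<close> of modulus 1 cuts the sphere into finitely many closed pieces
  of the cube.\<close>

lemma compact_max_norm_sphere:
  "compact {f :: nat \<Rightarrow> real. (\<forall>i. f i \<in> (if i < n then {-1..1} else {0})) \<and> (\<exists>j<n. \<bar>f j\<bar> = 1)}"
    (is "compact ?K")
proof -
  define S where "S = (\<lambda>i. if i < n then {-1..1} else {0 :: real})"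
  have "compactin (product_topology (\<lambda>i. euclidean) UNIV) (Pi\<^sub>E UNIV S)"
    by (subst compactin_PiE) (auto simp: S_def)
  then have c: "compact (Pi\<^sub>E UNIV S)"
    by (simp add: euclidean_product_topology)
  have "?K = (\<Union>j<n. Pi\<^sub>E UNIV S \<inter> {f. \<bar>f j\<bar> = 1})"
    by (auto simp: S_def PiE_def Pi_def)
  moreover have "compact (Pi\<^sub>E UNIV S \<inter> {f. \<bar>f j\<bar> = 1})" for j
    by (intro compact_Int_closed[OF c] closed_Collect_eq continuous_on_rabs
        continuous_on_product_coordinates continuous_on_const)
  ultimately show ?thesis using compact_UN[of "{..<n}" "\<lambda>j. Pi\<^sub>E UNIV S \<inter> {f. \<bar>f j\<bar> = 1}"] by simp
qed

lemma mat_minus_smult_form: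
  assumes "P \<in> carrier_mat n n" "S \<in> carrier_mat n n" "x \<in> carrier_vec n"
  shows "(\<mu> \<cdot>\<^sub>m P - S) *\<^sub>v x = \<mu> \<cdot>\<^sub>v (P *\<^sub>v x) - S *\<^sub>v (x :: real Matrix.vec)"
    "qform (\<mu> \<cdot>\<^sub>m P - S) x = \<mu> * qform P x - qform S x"
proof -
  have "(\<mu> \<cdot>\<^sub>m P) *\<^sub>v x = \<mu> \<cdot>\<^sub>v (P *\<^sub>v x)"
    using assms by (intro eq_vecI) auto
  then show 1: "(\<mu> \<cdot>\<^sub>m P - S) *\<^sub>v x = \<mu> \<cdot>\<^sub>v (P *\<^sub>v x) - S *\<^sub>v x"
    using assms by (simp add: minus_mult_distrib_mat_vec[of _ n n])
  show "qform (\<mu> \<cdot>\<^sub>m P - S) x = \<mu> * qform P x - qform S x"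
    unfolding 1 using assms by (simp add: scalar_prod_minus_distrib[of _ n])
qed

text \<open>
  The maximum \<open>\<mu>\<close> of the generalised Rayleigh quotient makes \<open>\<mu> P - S\<close> positive semidefinite
  and singular, so \<open>\<mu>\<close> is an eigenvalue of \<open>P\<^sup>-\<^sup>1 S\<close>.
\<close>

lemma rayleigh_le_lambda_max:
  assumes P: "pos_def_mat n P" and S: "S \<in> carrier_mat n n" "transpose_mat S = S"
    and x: "x \<in> carrier_vec n"
  shows "qform S x \<le> lambda_max (minv P * S) * qform P x"
\<comment> \<open>For \<open>n = 0\<close> the spectrum is empty and its \<open>Max\<close>
  unspecified, but then \<open>x\<close> is the zero vector and both sides are 0. A nonzero
  \<open>x\<close> also guarantees that the sphere below is not empty.\<close>
proof (cases "x = 0\<^sub>v n")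
  case True
  then show ?thesis using S pos_def_matD(1)[OF P] by simp
next
  case x0: False
  note P' = pos_def_matD[OF P]
  note I = minv_inverse[OF P'(1) pos_def_invertible[OF P]]
  define K where "K = {f :: nat \<Rightarrow> real. (\<forall>i. f i \<in> (if i < n then {-1..1} else {0})) \<and> (\<exists>j<n. \<bar>f j\<bar> = 1)}"
  have K0: "Matrix.vec n f \<noteq> 0\<^sub>v n" if f: "f \<in> K" for f
  proof
    assume eq: "Matrix.vec n f = 0\<^sub>v n"
    obtain j where "j < n" "\<bar>f j\<bar> = 1" using f by (auto simp: K_def)
    with arg_cong[OF eq, of "\<lambda>v. vec_index v j"] show False by simp
  qed
  have scale: "\<exists>f\<in>K. \<exists>r. y = r \<cdot>\<^sub>v Matrix.vec n f" if y: "y \<in> carrier_vec n" "y \<noteq> 0\<^sub>v n" for y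
  proof -
    \<comment> \<open>\<open>r\<close> is the maximum norm of \<open>y\<close>, so that
      \<open>y / r\<close> lies on the sphere.\<close>
    define r where "r = Max ((\<lambda>i. \<bar>vec_index y i\<bar>) ` {..<n})"
    obtain i where i: "i < n" "vec_index y i \<noteq> 0"
      using y by (metis carrier_vecD eq_vecI index_zero_vec)
    have le: "\<bar>vec_index y j\<bar> \<le> r" if "j < n" for j
      unfolding r_def using that by (intro Max_ge) auto
    have "r \<in> (\<lambda>i. \<bar>vec_index y i\<bar>) ` {..<n}"
      unfolding r_def using i by (intro Max_in) auto
    then obtain j where j: "j < n" "\<bar>vec_index y j\<bar> = r" by auto
    have r: "r > 0" using le[OF i(1)] i(2) by linarith
    define f where "f = (\<lambda>i. if i < n then vec_index y i / r else 0)"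
    have "f \<in> K"
    proof -
      have "f i \<in> {-1..1}" if "i < n" for i
        using le[OF that] r that by (auto simp: f_def abs_le_iff field_simps)
      moreover have "\<bar>f j\<bar> = 1" using j r by (simp add: f_def)
      moreover have "f i = 0" if "\<not> i < n" for i using that by (simp add: f_def)
      ultimately show ?thesis using j(1) unfolding K_def by auto
    qed
    moreover have "y = r \<cdot>\<^sub>v Matrix.vec n f"
      using y(1) r by (intro eq_vecI) (auto simp: f_def)
    ultimately show ?thesis by blast
  qed
  have "compact K" unfolding K_def by (rule compact_max_norm_sphere)
  moreover have "K \<noteq> {}" using scale[OF x x0] by blast
  moreover have "continuous_on K (\<lambda>f. qform S (Matrix.vec n f) / qform P (Matrix.vec n f))"
    using P'(3)[OF _ K0]
    by (intro continuous_on_divide continuous_on_subset[OF continuous_on_qform_vec] S(1) P'(1))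
      (auto simp: less_le)
  ultimately obtain g where g: "g \<in> K" and gmax: "\<And>f. f \<in> K \<Longrightarrow>
      qform S (Matrix.vec n f) / qform P (Matrix.vec n f)
        \<le> qform S (Matrix.vec n g) / qform P (Matrix.vec n g)"
    using continuous_attains_sup[of K] by blast
  define v where "v = Matrix.vec n g"
  define \<mu> where "\<mu> = qform S v / qform P v"
  have v: "v \<in> carrier_vec n" "v \<noteq> 0\<^sub>v n" using K0[OF g] by (auto simp: v_def)
  have le: "qform S y \<le> \<mu> * qform P y" if y: "y \<in> carrier_vec n" for y
  proof (cases "y = 0\<^sub>v n")
    case True
    then show ?thesis using S P'(1) by simp
  next
    case False
    then obtain f r where f: "f \<in> K" "y = r \<cdot>\<^sub>v Matrix.vec n f" using scale[OF y] by blast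
    have "qform S (Matrix.vec n f) \<le> \<mu> * qform P (Matrix.vec n f)"
      using gmax[OF f(1)] P'(3)[OF _ K0[OF f(1)]] by (simp add: \<mu>_def v_def field_simps)
    \<comment> \<open>Both forms are homogeneous of degree 2, which carries the bound from the
      sphere to all vectors.\<close>
    moreover have "qform A y = r\<^sup>2 * qform A (Matrix.vec n f)" if "A \<in> carrier_mat n n" for A
      using that unfolding f(2) by (simp add: mult_mat_vec[of _ n n] power2_eq_square)
    ultimately show ?thesis
      using S(1) P'(1) by (simp add: mult.left_commute[of \<mu>] mult_left_mono)
  qed
  define D where "D = \<mu> \<cdot>\<^sub>m P - S"
  note D_form = mat_minus_smult_form[OF P'(1) S(1), where \<mu> = \<mu>, folded D_def]
  have "D *\<^sub>v v = 0\<^sub>v n"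
  proof (rule psd_kernel)
    show "D \<in> carrier_mat n n" using P'(1) S by (auto simp: D_def)
    show "transpose_mat D = D"
    proof (rule eq_matI)
      fix i j assume ij: "i < dim_row D" "j < dim_col D"
      then have ij': "i < n" "j < n" using S(1) by (auto simp: D_def)
      have "P $$ (j, i) = P $$ (i, j)" "S $$ (j, i) = S $$ (i, j)"
        using ij' P'(1) S(1) arg_cong[OF P'(2), of "\<lambda>A. A $$ (i, j)"]
          arg_cong[OF S(2), of "\<lambda>A. A $$ (i, j)"] by auto
      then show "transpose_mat D $$ (i, j) = D $$ (i, j)"
        using ij' P'(1) S(1) by (simp add: D_def)
    qed (use S(1) P'(1) in \<open>auto simp: D_def\<close>)
    show "qform D y \<ge> 0" if "y \<in> carrier_vec n" for y
      using le[OF that] D_form(2)[OF that] by simp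
    show "qform D v = 0"
      using D_form(2)[OF v(1)] P'(3)[OF v] by (simp add: \<mu>_def)
  qed (use v in auto)
  then have eq0: "\<mu> \<cdot>\<^sub>v (P *\<^sub>v v) - S *\<^sub>v v = 0\<^sub>v n" using D_form(1)[OF v(1)] by simp
  have eq: "S *\<^sub>v v = \<mu> \<cdot>\<^sub>v (P *\<^sub>v v)"
  proof (rule eq_vecI)
    fix i assume "i < dim_vec (\<mu> \<cdot>\<^sub>v (P *\<^sub>v v))"
    with arg_cong[OF eq0, of "\<lambda>u. vec_index u i"] S(1) P'(1)
    show "vec_index (S *\<^sub>v v) i = vec_index (\<mu> \<cdot>\<^sub>v (P *\<^sub>v v)) i" by simp
  qed (use S(1) P'(1) in auto)
  \<comment> \<open>Multiplying \<open>S v = \<mu> P v\<close> by the inverse of \<open>P\<close>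
    makes \<open>v\<close> an eigenvector.\<close>
  have "(minv P * S) *\<^sub>v v = minv P *\<^sub>v (S *\<^sub>v v)"
    using I(1) S(1) v(1) by (rule assoc_mult_mat_vec)
  also have "\<dots> = \<mu> \<cdot>\<^sub>v (minv P *\<^sub>v (P *\<^sub>v v))"
    unfolding eq using I(1) P'(1) v(1) by (intro mult_mat_vec[of _ n n]) auto
  also have "minv P *\<^sub>v (P *\<^sub>v v) = v"
    using assoc_mult_mat_vec[OF I(1) P'(1) v(1)] I(3) v(1) by simp
  finally have "eigenvalue (minv P * S) \<mu>"
    using v I(1) by (auto simp: eigenvalue_def eigenvector_def)
  moreover have "finite (spectrum (minv P * S))"
    using card_finite_spectrum[of "minv P * S" n] I(1) S(1) by simp
  ultimately have "\<mu> \<le> lambda_max (minv P * S)"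
    unfolding lambda_max_def spectrum_def by (intro Max_ge) auto
  from mult_right_mono[OF this P'(4)[OF x]] le[OF x] show ?thesis by linarith
qed

text \<open>This inclusion of ellipsoids is the form in which both eigenvalue conditions are used;
  it also gives the boundedness of the demand.\<close>

lemma psd_qform_le:
  assumes P: "pos_def_mat n P" and S: "S \<in> carrier_mat n n" "transpose_mat S = S"
    and psd: "qform S x \<ge> 0" and x: "x \<in> carrier_vec n" "qform P x \<le> c"
    and c: "c * lambda_max (minv P * S) \<le> d" and d: "d \<ge> 0"
  shows "qform S x \<le> d"
proof (cases "x = 0\<^sub>v n")
  case True
  then show ?thesis using S d by simp
next
  case False
  note le = rayleigh_le_lambda_max[OF P S x(1)]
  have "qform P x > 0" using pos_def_matD(3)[OF P x(1) False] .
  \<comment> \<open>The sign of the eigenvalue is needed in order to multiply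
    \<open>qform P x \<le> c\<close> by it; it follows from the two forms at the nonzero vector
    \<open>x\<close>.\<close>
  moreover have "0 \<le> lambda_max (minv P * S) * qform P x" using le psd by linarith
  ultimately have "lambda_max (minv P * S) \<ge> 0" by (simp add: zero_le_mult_iff)
  from mult_right_mono[OF x(2) this] le c show ?thesis by (simp add: mult.commute)
qed

section \<open>The feedback matrix\<close>

text \<open>The shape \<open>K^T R K\<close> occurs twice: \<open>Phi_mat\<close> is the case
  \<open>K = H\<close>, and the matrix inverted in \<open>M_mat\<close> is another. Moving
  \<open>K^T\<close> to the other side of the scalar product evaluates its form.\<close>

lemma congruence_form:
  assumes R: "R \<in> carrier_mat m m" "transpose_mat R = R" and K: "K \<in> carrier_mat m l"
  shows "transpose_mat K * R * K \<in> carrier_mat l l"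
    "transpose_mat (transpose_mat K * R * K) = transpose_mat K * R * K"
    "v \<in> carrier_vec l \<Longrightarrow> qform (transpose_mat K * R * K) v = qform R (K *\<^sub>v v)"
proof -
  have KT: "transpose_mat K \<in> carrier_mat l m" using K by simp
  show "transpose_mat K * R * K \<in> carrier_mat l l" using R K by auto
  have "transpose_mat (transpose_mat K * R * K) = transpose_mat K * (transpose_mat R * K)"
    using R(1) K KT transpose_mult[of "transpose_mat K * R" l m K l] transpose_mult[OF KT R(1)]
    by simp
  then show "transpose_mat (transpose_mat K * R * K) = transpose_mat K * R * K"
    using R K KT assoc_mult_mat[OF KT R(1) K] by simp
  assume v: "v \<in> carrier_vec l"
  have Kv: "K *\<^sub>v v \<in> carrier_vec m" using K v by auto
  have "transpose_mat K * R * K *\<^sub>v v = transpose_mat K *\<^sub>v (R *\<^sub>v (K *\<^sub>v v))"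
    using assoc_mult_mat_vec[of "transpose_mat K * R" l m K l v] assoc_mult_mat_vec[OF KT R(1) Kv]
      KT R(1) K v by auto
  then have "qform (transpose_mat K * R * K) v = scalar_prod (transpose_mat K *\<^sub>v (R *\<^sub>v (K *\<^sub>v v))) v"
    using v KT R(1) Kv by (simp add: comm_scalar_prod[of v l])
  also have "\<dots> = scalar_prod (R *\<^sub>v (K *\<^sub>v v)) (K *\<^sub>v v)"
    using K v R(1) Kv by (intro transpose_vec_mult_scalar) auto
  also have "\<dots> = qform R (K *\<^sub>v v)"
    using Kv R(1) by (intro comm_scalar_prod[of _ m]) auto
  finally show "qform (transpose_mat K * R * K) v = qform R (K *\<^sub>v v)" .
qed

lemma pos_def_congruence:
  assumes R: "pos_def_mat m R" and K: "K \<in> carrier_mat m l"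
    and inj: "\<And>v. v \<in> carrier_vec l \<Longrightarrow> v \<noteq> 0\<^sub>v l \<Longrightarrow> K *\<^sub>v v \<noteq> 0\<^sub>v m"
  shows "pos_def_mat l (transpose_mat K * R * K)"
  using congruence_form[OF pos_def_matD(1,2)[OF R] K] pos_def_matD(3)[OF R _ inj] K
  by (auto simp: pos_def_mat_def)

text \<open>Both stackings are four-block matrices with empty blocks; in their block product only
  the upper left block has entries.\<close>

lemma append_cols_mult_append_rows:
  assumes "A \<in> carrier_mat n k" "C \<in> carrier_mat n l" "D \<in> carrier_mat k r" "E \<in> carrier_mat l r"
  shows "(A @\<^sub>c C) * (D @\<^sub>r E) = A * D + C * E"
proof -
  have "(A @\<^sub>c C) * (D @\<^sub>r E) = four_block_mat (A * D + C * E)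
      (A * 0\<^sub>m k 0 + C * 0\<^sub>m l 0) (0\<^sub>m 0 k * D + 0\<^sub>m 0 l * E) (0\<^sub>m 0 k * 0\<^sub>m k 0 + 0\<^sub>m 0 l * 0\<^sub>m l 0)"
    unfolding append_cols_def append_rows_def using assms
    by (subst mult_four_block_mat[of _ n k _ l _ 0 _ _ r _ 0]) auto
  also have "\<dots> = A * D + C * E"
    using assms by (intro eq_matI) (auto simp: four_block_mat_def Let_def)
  finally show ?thesis .
qed

lemma transpose_append_rows:
  assumes "A \<in> carrier_mat k n" "C \<in> carrier_mat l n"
  shows "transpose_mat (A @\<^sub>r C) = transpose_mat A @\<^sub>c transpose_mat C"
  using assms by (intro eq_matI) (auto simp: append_rows_def append_cols_def four_block_mat_def Let_def)

text \<open>Even the dimensions of \<open>M_mat\<close> are known only once the matrix inside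
  \<open>minv\<close> is invertible. That matrix is \<open>K^T R K\<close>, positive definite
  because the identity block makes \<open>K\<close> injective.\<close>

lemma M_mat_carrier:
  assumes Bb: "Bb \<in> carrier_mat n n" "invertible_mat Bb" and N: "N \<in> carrier_mat n l"
    and R: "pos_def_mat (n + l) R"
  shows "M_mat Bb N R \<in> carrier_mat l n"
proof -
  note I = minv_inverse[OF Bb]
  define K where "K = (- (minv Bb * N)) @\<^sub>r 1\<^sub>m l"
  have K: "K \<in> carrier_mat (n + l) l" using I(1) N by (auto simp: K_def)
  \<comment> \<open>The left factor in the definition of \<open>M_mat\<close> is the transpose of
    \<open>K\<close>, which turns the product into a congruence.\<close>
  have L: "(- (transpose_mat N * transpose_mat (minv Bb))) @\<^sub>c 1\<^sub>m l = transpose_mat K"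
    unfolding K_def using I(1) N transpose_mult[OF I(1) N]
    by (subst transpose_append_rows[of _ n l _ l]) (auto simp: transpose_uminus)
  have "pos_def_mat l (transpose_mat K * R * K)"
  proof (rule pos_def_congruence[OF R K])
    fix v :: "real Matrix.vec" assume v: "v \<in> carrier_vec l" "v \<noteq> 0\<^sub>v l"
    obtain i where i: "i < l" "vec_index v i \<noteq> 0"
      using v by (metis carrier_vecD eq_vecI index_zero_vec)
    \<comment> \<open>The last \<open>l\<close> entries of \<open>K v\<close> are \<open>v\<close>
      itself.\<close>
    have "K *\<^sub>v v = (- (minv Bb * N) *\<^sub>v v) @\<^sub>v (1\<^sub>m l *\<^sub>v v)"
      unfolding K_def using I(1) N v(1) by (intro mat_mult_append[of _ n l _ l]) auto
    then have "vec_index (K *\<^sub>v v) (n + i) = vec_index v i"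
      using I(1) N v(1) i by simp
    with i show "K *\<^sub>v v \<noteq> 0\<^sub>v (n + l)" by auto
  qed
  note X = minv_inverse(1)[OF pos_def_matD(1)[OF this] pos_def_invertible[OF this]]
  have "minv Bb @\<^sub>r 0\<^sub>m l n \<in> carrier_mat (n + l) n" using I(1) by auto
  with X K pos_def_matD(1)[OF R] have
    "minv (transpose_mat K * R * K) * (transpose_mat K * R * (minv Bb @\<^sub>r 0\<^sub>m l n)) \<in> carrier_mat l n"
    by (metis mult_carrier_mat transpose_carrier_mat)
  then show ?thesis
    using Bb(1) N L by (simp add: M_mat_def Let_def K_def)
qed

text \<open>With \<open>K = [- Bb^-1 N; I]\<close>, \<open>H_ordered\<close> is
  \<open>[Bb^-1; 0] - K M\<close>. The columns of \<open>K\<close> lie in the kernel of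
  \<open>Bb @\<^sub>c N\<close>, so the terms with \<open>M\<close> cancel and
  \<open>Bb Bb^-1\<close> remains.\<close>

lemma H_ordered_right_inverse:
  assumes Bb: "Bb \<in> carrier_mat n n" "invertible_mat Bb" and N: "N \<in> carrier_mat n l"
    and R: "pos_def_mat (n + l) R"
  shows "H_ordered Bb N R \<in> carrier_mat (n + l) n"
    "(Bb @\<^sub>c N) * H_ordered Bb N R = 1\<^sub>m n"
proof -
  note I = minv_inverse[OF Bb]
  define M where "M = M_mat Bb N R"
  have M: "M \<in> carrier_mat l n" unfolding M_def by (rule M_mat_carrier[OF assms])
  have IN: "minv Bb * N \<in> carrier_mat n l" and NM: "N * M \<in> carrier_mat n n" using I(1) N M by auto
  show "H_ordered Bb N R \<in> carrier_mat (n + l) n"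
    unfolding H_ordered_def using I(1) IN M by (auto simp: M_def)
  have "(Bb @\<^sub>c N) * H_ordered Bb N R = Bb * (minv Bb + minv Bb * N * M) + N * (- M)"
    unfolding H_ordered_def M_def[symmetric] using Bb(1) N I(1) IN M
    by (intro append_cols_mult_append_rows) auto
  also have "Bb * (minv Bb + minv Bb * N * M) = Bb * minv Bb + Bb * (minv Bb * N * M)"
    using Bb(1) I(1) IN M by (intro mult_add_distrib_mat) auto
  also have "Bb * (minv Bb * N * M) = Bb * minv Bb * (N * M)"
    using Bb(1) I(1) N M NM by (simp add: assoc_mult_mat[of _ n n _ l _ n] assoc_mult_mat[of _ n n _ n _ n])
  also have "\<dots> = N * M" using I(2) left_mult_one_mat[OF NM] by simp
  also have "N * (- M) = - (N * M)" using N M by simp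
  also have "Bb * minv Bb + N * M + - (N * M) = 1\<^sub>m n"
    unfolding I(2) using NM by (intro eq_matI) (simp_all del: index_mult_mat)
  finally show "(Bb @\<^sub>c N) * H_ordered Bb N R = 1\<^sub>m n" .
qed

section \<open>Reordering the input components\<close>

text \<open>Permuting rows and columns simultaneously is a congruence with a permutation matrix: the
  new form at \<open>v\<close> is the old form at the permuted vector.\<close>

lemma pos_def_reorder:
  assumes R: "pos_def_mat m R" and p: "p permutes {..<m}"
  shows "pos_def_mat m (reorder_rows p (reorder_cols p R))"
proof -
  note R' = pos_def_matD[OF R]
  have lt: "p i < m \<longleftrightarrow> i < m" "inv_into UNIV p i < m \<longleftrightarrow> i < m" for i
    using permutes_in_image[OF p, of i] permutes_in_image[OF permutes_inv[OF p], of i] by auto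
  have pinv: "inv_into UNIV p (p i) = i" "p (inv_into UNIV p i) = i" for i using permutes_inverses[OF p] by auto
  let ?R = "reorder_rows p (reorder_cols p R)"
  have entry: "?R $$ (i, j) = R $$ (p i, p j)" if "i < m" "j < m" for i j
    using that R'(1) lt by (simp add: reorder_rows_def reorder_cols_def)
  have c: "?R \<in> carrier_mat m m" using R'(1) by (auto simp: reorder_rows_def reorder_cols_def)
  have "transpose_mat ?R = ?R"
  proof (rule eq_matI)
    fix i j assume "i < dim_row ?R" "j < dim_col ?R"
    then have ij: "i < m" "j < m" using c by auto
    then show "transpose_mat ?R $$ (i, j) = ?R $$ (i, j)"
      using c entry[of i j] entry[of j i] R'(1) lt
        arg_cong[OF R'(2), of "\<lambda>A. A $$ (p i, p j)"] by simp
  qed (use c in auto)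
  moreover have "qform ?R v > 0" if v: "v \<in> carrier_vec m" "v \<noteq> 0\<^sub>v m" for v
  proof -
    \<comment> \<open>\<open>y\<close> is \<open>v\<close> carried back to the old order of the
      components.\<close>
    define y where "y = Matrix.vec m (\<lambda>i. vec_index v (inv_into UNIV p i))"
    have y: "y \<in> carrier_vec m" by (simp add: y_def)
    have yp: "vec_index y (p i) = vec_index v i" if "i < m" for i
      using that lt pinv by (simp add: y_def)
    obtain i where i: "i < m" "vec_index v i \<noteq> 0"
      using v by (metis carrier_vecD eq_vecI index_zero_vec)
    have "y \<noteq> 0\<^sub>v m"
      using yp[OF i(1)] i lt by (metis index_zero_vec(1))
    then have "qform R y > 0" by (rule R'(3)[OF y])
    also have "qform R y = (\<Sum>i<m. vec_index y i * (\<Sum>j<m. R $$ (i, j) * vec_index y j))"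
      using R'(1) y by (simp add: scalar_prod_def atLeast0LessThan)
    also have "\<dots> = (\<Sum>i<m. vec_index y (p i) * (\<Sum>j<m. R $$ (p i, j) * vec_index y j))"
      by (subst sum.permute[OF p]) simp
    also have "\<dots> = (\<Sum>i<m. vec_index y (p i) * (\<Sum>j<m. R $$ (p i, p j) * vec_index y (p j)))"
      by (subst sum.permute[OF p]) simp
    also have "\<dots> = (\<Sum>i<m. vec_index v i * (\<Sum>j<m. ?R $$ (i, j) * vec_index v j))"
      by (simp add: yp entry)
    also have "\<dots> = qform ?R v"
      using c v by (simp add: scalar_prod_def atLeast0LessThan)
    finally show ?thesis .
  qed
  ultimately show ?thesis using c by (auto simp: pos_def_mat_def)
qed

text \<open>Column \<open>l\<close> of the reordered \<open>B\<close> is column \<open>p l\<close>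
  of \<open>B\<close>, and row \<open>p l\<close> of \<open>H_mat\<close> is row \<open>l\<close> of
  \<open>G\<close>; summing over \<open>p l\<close> instead of \<open>l\<close> therefore identifies
  the two products.\<close>

lemma H_mat_right_inverse:
  assumes nm: "n \<le> m" and B: "B \<in> carrier_mat n m" and Ru: "pos_def_mat m Ru"
    and p: "p permutes {..<m}"
    and Bb: "Bb \<in> carrier_mat n n" "invertible_mat Bb" and N: "N \<in> carrier_mat n (m - n)"
    and eq: "reorder_cols p B = Bb @\<^sub>c N"
  shows "H_mat p Bb N Ru \<in> carrier_mat m n" "B * H_mat p Bb N Ru = 1\<^sub>m n"
proof -
  define G where "G = H_ordered Bb N (reorder_rows p (reorder_cols p Ru))"
  \<comment> \<open>The difference is truncated; \<open>n \<le> m\<close> gives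
    \<open>n + (m - n) = m\<close>.\<close>
  have "pos_def_mat (n + (m - n)) (reorder_rows p (reorder_cols p Ru))"
    using pos_def_reorder[OF Ru p] nm by simp
  note G = H_ordered_right_inverse[OF Bb N this, folded G_def]
  have Gc: "G \<in> carrier_mat m n" using G(1) nm by simp
  have lt: "p i < m \<longleftrightarrow> i < m" for i
    using permutes_in_image[OF p, of i] by auto
  have pinv: "inv_into UNIV p (p i) = i" for i using permutes_inverses[OF p] by auto
  let ?H = "H_mat p Bb N Ru"
  show H: "?H \<in> carrier_mat m n"
    using Gc by (auto simp: H_mat_def reorder_rows_def G_def)
  have entry: "?H $$ (p l, j) = G $$ (l, j)" if "l < m" "j < n" for l j
    using that Gc lt pinv by (simp add: H_mat_def reorder_rows_def G_def)
  have "(B * ?H) $$ (i, j) = (reorder_cols p B * G) $$ (i, j)" if ij: "i < n" "j < n" for i j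
  proof -
    have "(B * ?H) $$ (i, j) = (\<Sum>l<m. B $$ (i, l) * ?H $$ (l, j))"
      using ij B H by (simp add: scalar_prod_def atLeast0LessThan)
    also have "\<dots> = (\<Sum>l<m. B $$ (i, p l) * ?H $$ (p l, j))"
      by (subst sum.permute[OF p]) simp
    also have "\<dots> = (\<Sum>l<m. reorder_cols p B $$ (i, l) * G $$ (l, j))"
      using ij B by (intro sum.cong) (auto simp: reorder_cols_def entry)
    also have "\<dots> = (reorder_cols p B * G) $$ (i, j)"
      using ij B Gc by (simp add: scalar_prod_def atLeast0LessThan reorder_cols_def)
    finally show ?thesis .
  qed
  then have "B * ?H = reorder_cols p B * G"
    using B H Gc by (intro eq_matI) (auto simp: reorder_cols_def)
  then show "B * ?H = 1\<^sub>m n" unfolding eq G(2) .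
qed

section \<open>The closed loop\<close>

text \<open>The right-hand side is the solution \<open>E\<close> of \<open>E' = k (c - E)\<close>
  with \<open>E 0 = X 0\<close>, taken at \<open>T\<close>. If \<open>D = X - E\<close> were
  positive at \<open>T\<close>, then from the last time with \<open>D \<le> 0\<close> onwards
  \<open>D\<close> would be nonnegative and hence could not grow. Growth is in integral form because
  \<open>X\<close> need not be differentiable.\<close>

lemma decay_comparison:
  fixes X :: "real \<Rightarrow> real"
  assumes k: "k > 0" and T: "T \<ge> 0" and X: "continuous_on {0..T} X"
    and growth: "\<And>a b. 0 \<le> a \<Longrightarrow> a \<le> b \<Longrightarrow> b \<le> T \<Longrightarrow>
      X b - X a \<le> integral {a..b} (\<lambda>s. k * c - k * X s)"
  shows "X T \<le> exp (- k * T) * X 0 + (1 - exp (- k * T)) * c"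
proof (rule ccontr)
  define E where "E = (\<lambda>s. c + exp (- k * s) * (X 0 - c))"
  define D where "D = (\<lambda>s. X s - E s)"
  assume "\<not> ?thesis"
  then have DT: "D T > 0" by (simp add: D_def E_def algebra_simps)
  have contE: "continuous_on S E" for S
    unfolding E_def by (intro continuous_intros)
  have contD: "continuous_on {0..T} D"
    unfolding D_def by (intro continuous_on_diff X contE)
  have E: "((\<lambda>s. k * c - k * E s) has_integral E b - E a) {a..b}" if "a \<le> b" for a b
    using that unfolding E_def
    by (intro fundamental_theorem_of_calculus)
      (auto simp: has_real_derivative_iff_has_vector_derivative[symmetric] algebra_simps
        intro!: derivative_eq_intros)
  have D: "D b - D a \<le> integral {a..b} (\<lambda>s. - (k * D s))" if "0 \<le> a" "a \<le> b" "b \<le> T" for a b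
  proof -
    have "(\<lambda>s. k * c - k * X s) integrable_on {a..b}"
      by (rule integrable_continuous_real)
        (use that in \<open>intro continuous_intros continuous_on_subset[OF X], auto\<close>)
    then have "integral {a..b} (\<lambda>s. (k * c - k * X s) - (k * c - k * E s)) =
        integral {a..b} (\<lambda>s. k * c - k * X s) - (E b - E a)"
      using E[OF that(2)] by (subst integral_diff) (auto simp: integral_unique)
    moreover have "(\<lambda>s. (k * c - k * X s) - (k * c - k * E s)) = (\<lambda>s. - (k * D s))"
      by (auto simp: D_def algebra_simps)
    ultimately show ?thesis using growth[OF that] by (simp add: D_def)
  qed
  define Z where "Z = {0..T} \<inter> D -` {..0}"
  have "closed Z"
    unfolding Z_def using contD by (intro continuous_closed_preimage) auto
  moreover have Z0: "0 \<in> Z" using T by (simp add: Z_def D_def E_def)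
  moreover have bdd: "bdd_above Z" by (auto simp: Z_def intro: bdd_aboveI[of _ T])
  ultimately have "Sup Z \<in> Z" by (intro closed_contains_Sup) auto
  \<comment> \<open>\<open>a\<close> is the last time in \<open>[0, T]\<close> at which
    \<open>D \<le> 0\<close>.\<close>
  define a where "a = Sup Z"
  have a: "0 \<le> a" "a \<le> T" "D a \<le> 0" using \<open>Sup Z \<in> Z\<close> by (auto simp: a_def Z_def)
  have "continuous_on {a..T} D" by (rule continuous_on_subset[OF contD]) (use a in auto)
  \<comment> \<open>A zero of \<open>D\<close> at or after \<open>a\<close> can only be
    \<open>a\<close> itself, so \<open>D a = 0\<close>; this settles the left endpoint of the sign
    claim below.\<close>
  then obtain z where z: "a \<le> z" "z \<le> T" "D z = 0"
    using IVT'[of D a 0 T] a DT by auto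
  then have "z \<in> Z" using a by (simp add: Z_def)
  then have "z = a" using cSup_upper[OF _ bdd] z by (force simp: a_def)
  have "D s \<ge> 0" if "s \<in> {a..T}" for s
  proof (rule ccontr)
    assume "\<not> D s \<ge> 0"
    then have "s \<in> Z" using that a by (simp add: Z_def)
    then have "s = a" using cSup_upper[OF _ bdd] that by (force simp: a_def)
    with \<open>\<not> D s \<ge> 0\<close> z \<open>z = a\<close> show False by simp
  qed
  moreover have "(\<lambda>s. - (k * D s)) integrable_on {a..T}"
    by (rule integrable_continuous_real) (intro continuous_intros \<open>continuous_on {a..T} D\<close>)
  ultimately have "integral {a..T} (\<lambda>s. - (k * D s)) \<le> integral {a..T} (\<lambda>s. 0)"
    using k by (intro integral_le) auto
  with D[OF a(1,2)] z \<open>z = a\<close> DT show False by simp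
qed

text \<open>
  With \<open>W\<close> the primitive of the merely integrable forcing \<open>w\<close>, the function \<open>z = x + W\<close> solves
  \<open>z' = - k (z - W)\<close>, whose forcing is continuous, so variation of constants applies classically.
\<close>

lemma scalar_linear_ode_solution:
  fixes w :: "real \<Rightarrow> real"
  assumes w: "\<And>t. t \<ge> 0 \<Longrightarrow> w absolutely_integrable_on {0..t}"
  obtains x where "x 0 = x0"
    "\<And>t. t \<ge> 0 \<Longrightarrow> (\<lambda>s. - k * x s - w s) absolutely_integrable_on {0..t}"
    "\<And>t. t \<ge> 0 \<Longrightarrow> x t = x0 + integral {0..t} (\<lambda>s. - k * x s - w s)"
proof -
  define W where "W = (\<lambda>t. integral {0..t} w)"
  \<comment> \<open>Variation of constants for \<open>z' = - k z + k W\<close> with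
    \<open>z 0 = x0\<close>; subtracting \<open>W\<close> returns to \<open>x\<close>.\<close>
  define F where "F = (\<lambda>t. integral {0..t} (\<lambda>s. k * exp (k * s) * W s))"
  define z where "z = (\<lambda>t. exp (- k * t) * (x0 + F t))"
  define x where "x = (\<lambda>t. z t - W t)"
  have wi: "w integrable_on {0..t}" if "t \<ge> 0" for t
    using w[OF that] by (rule set_lebesgue_integral_eq_integral(1))
  have contW: "continuous_on {0..t} W" if "t \<ge> 0" for t
    unfolding W_def by (intro indefinite_integral_continuous_1 wi that)
  have F': "(F has_real_derivative k * exp (k * s) * W s) (at s within {0..t})"
    if "0 \<le> s" "s \<le> t" for s t
    unfolding F_def has_real_derivative_iff_has_vector_derivative using that
    by (intro integral_has_vector_derivative continuous_intros contW) auto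
  have z': "(z has_real_derivative - k * x s) (at s within {0..t})" if "0 \<le> s" "s \<le> t" for s t
  proof -
    have "exp (- (k * s)) * exp (k * s) = 1" by (simp add: exp_minus)
    then show ?thesis
      unfolding z_def x_def
      by (auto intro!: derivative_eq_intros F'[OF that] simp: algebra_simps)
  qed
  have contx: "continuous_on {0..t} x" if "t \<ge> 0" for t
  proof -
    have "continuous_on {0..t} z" by (rule DERIV_continuous_on[OF z']) auto
    then show ?thesis unfolding x_def by (intro continuous_on_diff contW that)
  qed
  have ac: "(\<lambda>s. - k * x s - w s) absolutely_integrable_on {0..t}" if "t \<ge> 0" for t
  proof -
    have "(\<lambda>s. - k * x s) absolutely_integrable_on {0..t}"
      by (intro absolutely_integrable_continuous_real continuous_intros contx that)
    then show ?thesis using w[OF that] by (rule set_integral_diff(1))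
  qed
  have sol: "x t = x0 + integral {0..t} (\<lambda>s. - k * x s - w s)" if t: "t \<ge> 0" for t
  proof -
    \<comment> \<open>The fundamental theorem of calculus is applied to \<open>z\<close> only; the
      part with \<open>w\<close> integrates to \<open>W\<close> by definition.\<close>
    have "((\<lambda>s. - k * x s) has_integral z t - z 0) {0..t}"
      using t z' by (intro fundamental_theorem_of_calculus)
        (auto simp: has_real_derivative_iff_has_vector_derivative)
    then have "((\<lambda>s. - k * x s - w s) has_integral z t - z 0 - W t) {0..t}"
      unfolding W_def by (intro has_integral_diff integrable_integral wi t)
    then show ?thesis
      by (simp add: integral_unique x_def) (simp add: z_def F_def)
  qed
  show thesis
    by (rule that[OF _ ac sol]) (simp add: x_def z_def F_def W_def)
qed

text \<open>A measurable function that is bounded on a bounded interval is integrable. The bound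
  compares the Euclidean norm with the form of \<open>R\<close>, with the identity matrix as second
  form.\<close>

lemma demand_absolutely_integrable:
  assumes R: "pos_def_mat n R" and w: "demand n (ellipsoid n R 1) w" and i: "i < n" and t: "t \<ge> 0"
  shows "(\<lambda>s. vec_index (w s) i) absolutely_integrable_on {0..t}"
proof (rule measurable_bounded_by_integrable_imp_absolutely_integrable)
  have "(\<lambda>s. vec_index (w s) i) \<in> borel_measurable (lebesgue_on {0..})"
    using w i by (simp add: demand_def)
  then show "(\<lambda>s. vec_index (w s) i) \<in> borel_measurable (lebesgue_on {0..t})"
    by (rule measurable_restrict_mono) auto
  \<comment> \<open>The maximum with 0 supplies the nonnegative bound that
    \<open>psd_qform_le\<close> asks for.\<close>
  define d where "d = max 0 (lambda_max (minv R * 1\<^sub>m n))"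
  fix s assume "s \<in> {0..t}"
  then have ws: "w s \<in> carrier_vec n" "qform R (w s) \<le> 1"
    using w by (auto simp: demand_def ellipsoid_def)
  have sq: "qform (1\<^sub>m n) (w s) = (\<Sum>j<n. (vec_index (w s) j)\<^sup>2)"
    using ws by (simp add: scalar_prod_def atLeast0LessThan power2_eq_square)
  have "qform (1\<^sub>m n) (w s) \<le> d"
    by (rule psd_qform_le[OF R _ _ _ ws]) (auto simp: d_def sq intro: sum_nonneg)
  moreover have "(vec_index (w s) i)\<^sup>2 \<le> (\<Sum>j<n. (vec_index (w s) j)\<^sup>2)"
    using i by (intro member_le_sum) auto
  ultimately have "(vec_index (w s) i)\<^sup>2 \<le> d" using sq by simp
  then show "norm (vec_index (w s) i) \<le> sqrt d"
    by (simp add: real_le_rsqrt)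
qed auto

section \<open>Exponential estimate in the norm of \<open>P\<close>\<close>

text \<open>Pairing with the fixed vector \<open>P x(T)\<close> keeps the argument linear, so the
  integral equations of the coordinates can simply be combined. The norm returns at the end because
  \<open>X T\<close> is the square of the norm of \<open>x T\<close>.\<close>

lemma linear_trajectory_bound:
  assumes P: "pos_def_mat n P" and k: "k > 0" and T: "T \<ge> 0"
    and xc: "\<And>t. t \<ge> 0 \<Longrightarrow> x t \<in> carrier_vec n"
    and wc: "\<And>t. t \<ge> 0 \<Longrightarrow> w t \<in> carrier_vec n"
    and wP: "\<And>t. t \<ge> 0 \<Longrightarrow> qform P (w t) \<le> k\<^sup>2"
    and int: "\<And>i t. i < n \<Longrightarrow> t \<ge> 0 \<Longrightarrow>
      (\<lambda>s. - k * vec_index (x s) i - vec_index (w s) i) integrable_on {0..t}"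
    and sol: "\<And>i t. i < n \<Longrightarrow> t \<ge> 0 \<Longrightarrow> vec_index (x t) i =
      vec_index (x 0) i + integral {0..t} (\<lambda>s. - k * vec_index (x s) i - vec_index (w s) i)"
  shows "sqrt (qform P (x T)) \<le> 1 + exp (- k * T) * (sqrt (qform P (x 0)) - 1)"
proof -
  note P' = pos_def_matD[OF P]
  define q where "q = x T"
  have q: "q \<in> carrier_vec n" using xc[OF T] by (simp add: q_def)
  define r where "r = sqrt (qform P q)"
  define r0 where "r0 = sqrt (qform P (x 0))"
  have r: "r \<ge> 0" "r\<^sup>2 = qform P q" "r0 \<ge> 0" "r0\<^sup>2 = qform P (x 0)"
    using P'(4)[OF q] P'(4)[OF xc[of 0]] by (auto simp: r_def r0_def)
  define p where "p = P *\<^sub>v q"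
  define X where "X = (\<lambda>s. \<Sum>i<n. vec_index p i * vec_index (x s) i)"
  have pairing: "(\<Sum>i<n. vec_index p i * vec_index v i) = scalar_prod v (P *\<^sub>v q)"
    if "v \<in> carrier_vec n" for v
    using P'(1) q that by (auto simp: p_def scalar_prod_def atLeast0LessThan mult.commute)
  \<comment> \<open>This is used twice: with \<open>b = k\<close> for the demand and with
    \<open>b = r0\<close> for the initial state.\<close>
  have CS: "\<bar>scalar_prod v (P *\<^sub>v q)\<bar> \<le> b * r"
    if "v \<in> carrier_vec n" "qform P v \<le> b\<^sup>2" "b \<ge> 0" for v b
  proof -
    have "(scalar_prod v (P *\<^sub>v q))\<^sup>2 \<le> qform P v * qform P q"
      by (rule psd_cauchy_schwarz[OF P'(1,2,4) that(1) q])
    also have "\<dots> \<le> b\<^sup>2 * qform P q"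
      by (rule mult_right_mono[OF that(2) P'(4)[OF q]])
    also have "\<dots> = (b * r)\<^sup>2" using r by (simp add: power_mult_distrib)
    finally have "\<bar>scalar_prod v (P *\<^sub>v q)\<bar> \<le> \<bar>b * r\<bar>" by (rule abs_le_square_iff[THEN iffD2])
    then show ?thesis using that(3) r(1) by simp
  qed
  have contx: "continuous_on {0..T} (\<lambda>s. vec_index (x s) i)" if "i < n" for i
  proof -
    have "continuous_on {0..T} (\<lambda>t. vec_index (x 0) i +
        integral {0..t} (\<lambda>s. - k * vec_index (x s) i - vec_index (w s) i))"
      by (intro continuous_on_add continuous_on_const indefinite_integral_continuous_1 int that T)
    then show ?thesis
      by (rule continuous_on_eq) (rule sol[OF that, symmetric], simp)
  qed
  have contX: "continuous_on {0..T} X"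
    unfolding X_def by (intro continuous_on_sum continuous_on_mult continuous_on_const contx) auto
  have "X T \<le> exp (- k * T) * X 0 + (1 - exp (- k * T)) * r"
  proof (rule decay_comparison[OF k T contX])
    fix a b assume ab: "0 \<le> a" "a \<le> b" "b \<le> T"
    let ?g = "\<lambda>i s. - k * vec_index (x s) i - vec_index (w s) i"
    have gi: "?g i integrable_on {a..b}" if "i < n" for i
      by (rule integrable_on_subinterval[OF int[OF that, of b]]) (use ab in auto)
    have pgi: "(\<lambda>s. vec_index p i * ?g i s) integrable_on {a..b}" if "i < n" for i
      using integrable_cmul[OF gi[OF that], of "vec_index p i"] by simp
    have "vec_index (x b) i - vec_index (x a) i = integral {a..b} (?g i)" if "i < n" for i
    proof -
      have "integral {0..a} (?g i) + integral {a..b} (?g i) = integral {0..b} (?g i)"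
        using ab by (intro Henstock_Kurzweil_Integration.integral_combine int that) auto
      with sol[OF that, of a] sol[OF that, of b] ab show ?thesis by linarith
    qed
    then have "(\<Sum>i<n. vec_index p i * (vec_index (x b) i - vec_index (x a) i)) =
        (\<Sum>i<n. vec_index p i * integral {a..b} (?g i))"
      by (intro sum.cong refl arg_cong2[of _ _ _ _ "(*)"]) simp_all
    moreover have "X b - X a = (\<Sum>i<n. vec_index p i * (vec_index (x b) i - vec_index (x a) i))"
      unfolding X_def by (simp only: right_diff_distrib sum_subtractf)
    ultimately have "X b - X a = (\<Sum>i<n. vec_index p i * integral {a..b} (?g i))" by simp
    also have "\<dots> = integral {a..b} (\<lambda>s. \<Sum>i<n. vec_index p i * ?g i s)"
      using pgi by (subst integral_sum) auto
    also have "\<dots> \<le> integral {a..b} (\<lambda>s. k * r - k * X s)"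
    proof (rule integral_le)
      show "(\<lambda>s. \<Sum>i<n. vec_index p i * ?g i s) integrable_on {a..b}"
        using pgi by (intro integrable_sum) auto
      show "(\<lambda>s. k * r - k * X s) integrable_on {a..b}"
        by (rule integrable_continuous_real)
          (use ab in \<open>intro continuous_intros continuous_on_subset[OF contX], auto\<close>)
      fix s assume s: "s \<in> {a..b}"
      then have s0: "s \<ge> 0" using ab by simp
      have "vec_index p i * ?g i s = - k * (vec_index p i * vec_index (x s) i) -
          vec_index p i * vec_index (w s) i" for i
        by (simp add: right_diff_distrib)
      then have "(\<Sum>i<n. vec_index p i * ?g i s) =
          - k * X s - (\<Sum>i<n. vec_index p i * vec_index (w s) i)"
        by (simp only: X_def sum_distrib_left sum_subtractf)
      \<comment> \<open>The worst demand pushes \<open>X\<close> up at rate \<open>k r\<close>,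
        which is the constant \<open>k c\<close> of the comparison with
        \<open>c = r\<close>.\<close>
      moreover have "- (\<Sum>i<n. vec_index p i * vec_index (w s) i) \<le> k * r"
        unfolding pairing[OF wc[OF s0]] using CS[OF wc[OF s0] wP[OF s0]] k by auto
      ultimately show "(\<Sum>i<n. vec_index p i * ?g i s) \<le> k * r - k * X s" by simp
    qed
    finally show "X b - X a \<le> integral {a..b} (\<lambda>s. k * r - k * X s)" .
  qed
  also have "\<dots> \<le> exp (- k * T) * (r0 * r) + (1 - exp (- k * T)) * r"
  proof -
    have "X 0 \<le> r0 * r"
      unfolding X_def pairing[OF xc[OF order_refl]] using CS[OF xc[OF order_refl], of r0] r by auto
    then show ?thesis by (simp add: mult_left_mono)
  qed
  also have "X T = r\<^sup>2"
    unfolding X_def pairing[OF xc[OF T]] r(2) by (simp add: q_def)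
  finally have le: "r * r \<le> r * (1 + exp (- k * T) * (r0 - 1))"
    by (simp add: power2_eq_square algebra_simps)
  have "r \<le> 1 + exp (- k * T) * (r0 - 1)"
  \<comment> \<open>Division by \<open>r\<close> requires \<open>r > 0\<close>. For
    \<open>r = 0\<close> the claim holds because its right-hand side is
    \<open>(1 - exp (- k * T)) + exp (- k * T) * r0\<close>, a sum of nonnegative terms.\<close>
  proof (cases "r = 0")
    case True
    have "exp (- k * T) \<le> 1" using k T by simp
    moreover have "exp (- k * T) * r0 \<ge> 0" using r by simp
    moreover have "exp (- k * T) * (r0 - 1) = exp (- k * T) * r0 - exp (- k * T)"
      by (simp add: right_diff_distrib)
    ultimately show ?thesis using True by linarith
  next
    case False
    with le r(1) show ?thesis by simp
  qed
  then show ?thesis by (simp add: r_def r0_def q_def)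
qed

section \<open>Distance to the target set\<close>

text \<open>The distance is estimated by the radial projection of \<open>x\<close> onto the
  ellipsoid, and the eigenvalue converts the norm of \<open>P\<close> into the Euclidean norm. The
  absolute value also covers \<open>n = 0\<close>, where \<open>lambda_max\<close> is
  unspecified.\<close>

lemma vsetdist_ellipsoid_le:
  assumes P: "pos_def_mat n P" and x: "x \<in> carrier_vec n"
  shows "0 \<le> vsetdist x (ellipsoid n P 1)"
    "vsetdist x (ellipsoid n P 1) \<le>
      sqrt \<bar>lambda_max (minv P * 1\<^sub>m n)\<bar> * max 0 (sqrt (qform P x) - 1)"
proof -
  note P' = pos_def_matD[OF P]
  define L where "L = lambda_max (minv P * 1\<^sub>m n)"
  define s where "s = sqrt (qform P x)"
  have s: "s \<ge> 0" "s\<^sup>2 = qform P x" using P'(4)[OF x] by (auto simp: s_def)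
  have nonneg: "0 \<le> vdist x y" for y
    by (auto simp: vdist_def scalar_prod_def intro: sum_nonneg)
  \<comment> \<open>The infimum is bounded below by 0 because it is taken over a nonempty
    set.\<close>
  have "0\<^sub>v n \<in> ellipsoid n P 1" using P'(1) by (simp add: ellipsoid_def)
  then show "0 \<le> vsetdist x (ellipsoid n P 1)"
    unfolding vsetdist_def using nonneg by (intro cINF_greatest) auto
  \<comment> \<open>The scaling factor of the radial projection; \<open>max 1 s\<close> leaves
    points of the ellipsoid where they are.\<close>
  define r where "r = 1 / max 1 s"
  have r: "0 \<le> r" "r \<le> 1" "r * s \<le> 1" "(1 - r) * s = max 0 (s - 1)"
    using s by (auto simp: r_def max_def field_simps)
  define y where "y = r \<cdot>\<^sub>v x"
  have "qform P y = (r * s)\<^sup>2"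
    using P'(1) x s by (simp add: y_def mult_mat_vec[of _ n n] power_mult_distrib power2_eq_square)
  also have "\<dots> \<le> 1" using r s by (simp add: power_le_one)
  finally have y: "y \<in> ellipsoid n P 1" using x by (simp add: ellipsoid_def y_def)
  have xx: "scalar_prod x x \<le> \<bar>L\<bar> * s\<^sup>2"
  proof -
    have "scalar_prod x x \<le> L * s\<^sup>2"
      using rayleigh_le_lambda_max[OF P _ _ x, of "1\<^sub>m n"] x by (simp add: L_def s)
    also have "\<dots> \<le> \<bar>L\<bar> * s\<^sup>2" by (intro mult_right_mono) auto
    finally show ?thesis .
  qed
  have "vsetdist x (ellipsoid n P 1) \<le> vdist x y"
    unfolding vsetdist_def using nonneg by (intro cINF_lower y bdd_belowI2[of _ 0]) auto
  also have "vdist x y = sqrt ((1 - r)\<^sup>2 * scalar_prod x x)"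
  proof -
    have "x - y = (1 - r) \<cdot>\<^sub>v x"
      using x by (intro eq_vecI) (auto simp: y_def algebra_simps)
    then show ?thesis using x by (simp add: vdist_def power2_eq_square)
  qed
  also have "\<dots> \<le> sqrt ((1 - r)\<^sup>2 * (\<bar>L\<bar> * s\<^sup>2))"
    by (intro real_sqrt_le_mono mult_left_mono xx) auto
  also have "\<dots> = sqrt \<bar>L\<bar> * ((1 - r) * s)"
    using r(2) s(1) by (simp add: real_sqrt_mult)
  finally show "vsetdist x (ellipsoid n P 1) \<le>
      sqrt \<bar>lambda_max (minv P * 1\<^sub>m n)\<bar> * max 0 (sqrt (qform P x) - 1)"
    using r(4) by (simp add: L_def s_def)
qed

section \<open>Existence, admissibility and convergence for the closed loop\<close>

text \<open>Existence of a closed-loop solution accompanies the claims about all solutions, so that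
  these are not vacuous.\<close>

theorem theorem3:
  fixes n m :: nat
    and B Bb N P Rw Ru H :: "real mat"
    and p :: "nat \<Rightarrow> nat"
    and k \<xi> :: real
  assumes "n \<le> m"
    and "B \<in> carrier_mat n m" and "elements_mat B \<subseteq> \<rat>" and "vec_space.rank n B = n"
    and "pos_def_mat n P" and "pos_def_mat n Rw" and "pos_def_mat m Ru"
    and "p permutes {..<m}"
    and "Bb \<in> carrier_mat n n" and "invertible_mat Bb" and "N \<in> carrier_mat n (m - n)"
    and "reorder_cols p B = Bb @\<^sub>c N"
    and "H = H_mat p Bb N Ru"
    and "k > 0" and "\<xi> \<ge> 1"
    and "k\<^sup>2 \<ge> lambda_max (minv Rw * P)"
    and "k\<^sup>2 * \<xi> * lambda_max (minv P * Phi_mat H Ru) \<le> 1"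
  shows "\<forall>w x0. demand n (ellipsoid n Rw 1) w \<longrightarrow> x0 \<in> ellipsoid n P \<xi> \<longrightarrow>
      (\<exists>x. trajectory n B (\<lambda>t. (- k) \<cdot>\<^sub>v (H *\<^sub>v x t)) w x \<and> x 0 = x0) \<and>
      (\<forall>x. trajectory n B (\<lambda>t. (- k) \<cdot>\<^sub>v (H *\<^sub>v x t)) w x \<and> x 0 = x0 \<longrightarrow>
         (\<forall>t\<ge>0. (- k) \<cdot>\<^sub>v (H *\<^sub>v x t) \<in> ellipsoid m Ru 1) \<and>
         ((\<lambda>t. vsetdist (x t) (ellipsoid n P 1)) \<longlongrightarrow> 0) at_top)"
proof (intro allI impI)
  fix w x0 assume w: "demand n (ellipsoid n Rw 1) w" and x0: "x0 \<in> ellipsoid n P \<xi>"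
  note B = assms(2) and P = assms(5) and Rw = assms(6) and Ru = assms(7) and k = assms(14)
  note P' = pos_def_matD[OF P]
  have H: "H \<in> carrier_mat m n" "B * H = 1\<^sub>m n"
    unfolding assms(13) by (rule H_mat_right_inverse[OF assms(1,2,7-12)])+
  have wc: "w t \<in> carrier_vec n" and wR: "qform Rw (w t) \<le> 1" if "t \<ge> 0" for t
    using w that by (auto simp: demand_def ellipsoid_def)
  \<comment> \<open>The first eigenvalue condition enters here: the ellipsoid of demands lies in the
    ball of radius \<open>k\<close> for the norm of \<open>P\<close>.\<close>
  have wP: "qform P (w t) \<le> k\<^sup>2" if "t \<ge> 0" for t
    by (rule psd_qform_le[OF Rw P'(1,2) P'(4)[OF wc[OF that]] wc[OF that] wR[OF that]])
      (use assms(16) in auto)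
  have x0c: "x0 \<in> carrier_vec n" and x0P: "qform P x0 \<le> \<xi>" using x0 by (auto simp: ellipsoid_def)
  \<comment> \<open>\<open>B H = I\<close> decouples the closed loop into \<open>n\<close> scalar
    equations.\<close>
  have closed_loop: "vec_index (B *\<^sub>v ((- k) \<cdot>\<^sub>v (H *\<^sub>v y)) - w s) i = - k * vec_index y i - vec_index (w s) i"
    if "y \<in> carrier_vec n" "i < n" "s \<ge> 0" for y s i
  proof -
    have "B *\<^sub>v (H *\<^sub>v y) = y"
      using assoc_mult_mat_vec[OF B H(1) that(1)] H(2) that(1) by simp
    moreover have "B *\<^sub>v ((- k) \<cdot>\<^sub>v (H *\<^sub>v y)) = (- k) \<cdot>\<^sub>v (B *\<^sub>v (H *\<^sub>v y))"
      using B H(1) that(1) by (intro mult_mat_vec[of _ n m]) auto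
    ultimately show ?thesis using that wc[OF that(3)] by simp
  qed
  have trajectory_iff: "trajectory n B (\<lambda>t. (- k) \<cdot>\<^sub>v (H *\<^sub>v x t)) w x \<longleftrightarrow>
      (\<forall>t\<ge>0. x t \<in> carrier_vec n) \<and> (\<forall>t\<ge>0. \<forall>i<n.
        (\<lambda>s. - k * vec_index (x s) i - vec_index (w s) i) absolutely_integrable_on {0..t} \<and>
        vec_index (x t) i = vec_index (x 0) i +
          integral {0..t} (\<lambda>s. - k * vec_index (x s) i - vec_index (w s) i))" for x
  \<comment> \<open>The integrand can be rewritten only where \<open>x s\<close> has dimension
    \<open>n\<close>; if that fails somewhere, both sides are false by their first conjunct.\<close>
  proof (cases "\<forall>t\<ge>0. x t \<in> carrier_vec n")
    case True
    have eq: "vec_index (B *\<^sub>v ((- k) \<cdot>\<^sub>v (H *\<^sub>v x s)) - w s) i = - k * vec_index (x s) i - vec_index (w s) i"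
      if "s \<in> {0..t}" "i < n" for s t i
      using closed_loop[of "x s" i s] True that by simp
    have abs_eq: "(\<lambda>s. vec_index (B *\<^sub>v ((- k) \<cdot>\<^sub>v (H *\<^sub>v x s)) - w s) i) absolutely_integrable_on {0..t} \<longleftrightarrow>
        (\<lambda>s. - k * vec_index (x s) i - vec_index (w s) i) absolutely_integrable_on {0..t}"
      if "i < n" for t i
      by (rule set_integrable_cong[OF refl refl eq[OF _ that]])
    have int_eq: "integral {0..t} (\<lambda>s. vec_index (B *\<^sub>v ((- k) \<cdot>\<^sub>v (H *\<^sub>v x s)) - w s) i) =
        integral {0..t} (\<lambda>s. - k * vec_index (x s) i - vec_index (w s) i)"
      if "i < n" for t i
      by (rule integral_cong[OF eq[OF _ that]])
    show ?thesis unfolding trajectory_def by (simp only: abs_eq int_eq cong: imp_cong)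
  next
    case False
    then show ?thesis unfolding trajectory_def by blast
  qed
  have "\<exists>x. trajectory n B (\<lambda>t. (- k) \<cdot>\<^sub>v (H *\<^sub>v x t)) w x \<and> x 0 = x0"
  proof -
    \<comment> \<open>\<open>Q i f\<close> says that \<open>f\<close> solves the scalar equation of
      coordinate \<open>i\<close>; a solution vector is assembled from one choice of
      \<open>f\<close> per coordinate.\<close>
    define Q where "Q = (\<lambda>i f. f 0 = vec_index x0 i \<and> (\<forall>t\<ge>0.
        (\<lambda>s. - k * f s - vec_index (w s) i) absolutely_integrable_on {0..t} \<and>
        f t = vec_index x0 i + integral {0..t} (\<lambda>s. - k * f s - vec_index (w s) i)))"
    have "\<exists>f. Q i f" if i: "i < n" for i
    proof (rule scalar_linear_ode_solution[OF demand_absolutely_integrable[OF Rw w i]])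
      fix f assume "f 0 = vec_index x0 i"
        and "\<And>t. t \<ge> 0 \<Longrightarrow> (\<lambda>s. - k * f s - vec_index (w s) i) absolutely_integrable_on {0..t}"
        and "\<And>t. t \<ge> 0 \<Longrightarrow>
          f t = vec_index x0 i + integral {0..t} (\<lambda>s. - k * f s - vec_index (w s) i)"
      then show "\<exists>f. Q i f" unfolding Q_def by blast
    qed
    then obtain f where f: "\<And>i. i < n \<Longrightarrow> Q i (f i)" by metis
    define x where "x = (\<lambda>t. Matrix.vec n (\<lambda>i. f i t))"
    note f = f[unfolded Q_def]
    have "x 0 = x0" using f x0c by (intro eq_vecI) (auto simp: x_def)
    moreover have "trajectory n B (\<lambda>t. (- k) \<cdot>\<^sub>v (H *\<^sub>v x t)) w x"
      unfolding trajectory_iff using f by (auto simp: x_def)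
    ultimately show ?thesis by blast
  qed
  moreover have "(\<forall>t\<ge>0. (- k) \<cdot>\<^sub>v (H *\<^sub>v x t) \<in> ellipsoid m Ru 1) \<and>
      ((\<lambda>t. vsetdist (x t) (ellipsoid n P 1)) \<longlongrightarrow> 0) at_top"
    if traj: "trajectory n B (\<lambda>t. (- k) \<cdot>\<^sub>v (H *\<^sub>v x t)) w x" and x_0: "x 0 = x0" for x
  proof
    have xc: "x t \<in> carrier_vec n" if "t \<ge> 0" for t using traj that by (simp add: trajectory_def)
    define r where "r = (\<lambda>t. sqrt (qform P (x t)))"
    have decay: "r t \<le> 1 + exp (- k * t) * (r 0 - 1)" if "t \<ge> 0" for t
      unfolding r_def
    proof (rule linear_trajectory_bound[OF P k that xc wc wP])
      fix i t assume i: "i < n" and t: "(t :: real) \<ge> 0"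
      show "(\<lambda>s. - k * vec_index (x s) i - vec_index (w s) i) integrable_on {0..t}"
        using traj i t unfolding trajectory_iff
        by (intro set_lebesgue_integral_eq_integral(1)) blast
      show "vec_index (x t) i = vec_index (x 0) i +
          integral {0..t} (\<lambda>s. - k * vec_index (x s) i - vec_index (w s) i)"
        using traj i t unfolding trajectory_iff by blast
    qed
    show "\<forall>t\<ge>0. (- k) \<cdot>\<^sub>v (H *\<^sub>v x t) \<in> ellipsoid m Ru 1"
    proof (intro allI impI)
      fix t :: real assume t: "t \<ge> 0"
      have "r 0 \<le> sqrt \<xi>" using x0P x_0 by (simp add: r_def)
      then have "exp (- k * t) * (r 0 - 1) \<le> exp (- k * t) * (sqrt \<xi> - 1)"
        by (intro mult_left_mono) auto
      \<comment> \<open>Replacing the exponential by 1 enlarges the product because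
        \<open>\<xi> \<ge> 1\<close> makes the second factor nonnegative.\<close>
      also have "\<dots> \<le> 1 * (sqrt \<xi> - 1)"
        using k t assms(15) by (intro mult_right_mono) auto
      finally have "r t \<le> sqrt \<xi>" using decay[OF t] by simp
      then have xP: "qform P (x t) \<le> \<xi>" by (simp add: r_def)
      note \<Phi> = congruence_form[OF pos_def_matD(1,2)[OF Ru] H(1), folded Phi_mat_def]
      have Hx: "H *\<^sub>v x t \<in> carrier_vec m" using H(1) xc[OF t] by auto
      \<comment> \<open>The second eigenvalue condition, divided by \<open>k\<^sup>2\<close>, enters
        here; the form of \<open>Phi_mat\<close> at \<open>x t\<close> is the cost of
        \<open>H x\<close>, and the control scales it by \<open>k\<^sup>2\<close>.\<close>
      have "qform (Phi_mat H Ru) (x t) \<le> 1 / k\<^sup>2"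
      proof (rule psd_qform_le[OF P \<Phi>(1,2) _ xc[OF t] xP])
        show "0 \<le> qform (Phi_mat H Ru) (x t)"
          using \<Phi>(3)[OF xc[OF t]] pos_def_matD(4)[OF Ru Hx] by simp
        show "\<xi> * lambda_max (minv P * Phi_mat H Ru) \<le> 1 / k\<^sup>2"
          using assms(17) k by (simp add: field_simps)
      qed simp
      then have "k\<^sup>2 * qform Ru (H *\<^sub>v x t) \<le> 1"
        using \<Phi>(3)[OF xc[OF t]] k by (simp add: field_simps)
      moreover have "qform Ru ((- k) \<cdot>\<^sub>v (H *\<^sub>v x t)) = k\<^sup>2 * qform Ru (H *\<^sub>v x t)"
        using pos_def_matD(1)[OF Ru] Hx by (simp add: mult_mat_vec[of _ m m] power2_eq_square)
      ultimately show "(- k) \<cdot>\<^sub>v (H *\<^sub>v x t) \<in> ellipsoid m Ru 1"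
        using Hx by (simp add: ellipsoid_def)
    qed
    \<comment> \<open>The modulus of \<open>r 0 - 1\<close> serves initial states inside and outside
      the target alike.\<close>
    define C where "C = sqrt \<bar>lambda_max (minv P * 1\<^sub>m n)\<bar> * \<bar>r 0 - 1\<bar>"
    have bound: "vsetdist (x t) (ellipsoid n P 1) \<le> C * exp (- k * t)" if "t \<ge> 0" for t
    proof -
      have "exp (- k * t) * (r 0 - 1) \<le> exp (- k * t) * \<bar>r 0 - 1\<bar>"
        by (intro mult_left_mono) auto
      then have "max 0 (r t - 1) \<le> exp (- k * t) * \<bar>r 0 - 1\<bar>"
        using decay[OF that] by (intro max.boundedI) (simp, linarith)
      then have "sqrt \<bar>lambda_max (minv P * 1\<^sub>m n)\<bar> * max 0 (r t - 1) \<le>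
          sqrt \<bar>lambda_max (minv P * 1\<^sub>m n)\<bar> * (exp (- k * t) * \<bar>r 0 - 1\<bar>)"
        by (intro mult_left_mono) auto
      with vsetdist_ellipsoid_le(2)[OF P xc[OF that]] show ?thesis
        by (simp add: C_def r_def mult_ac)
    qed
    \<comment> \<open>Positivity of \<open>k\<close> makes the exponential bound vanish at
      infinity.\<close>
    have lim: "((\<lambda>t. C * exp (- k * t)) \<longlongrightarrow> 0) at_top"
      using k by (intro tendsto_mult_right_zero filterlim_compose[OF exp_at_bot]
          filterlim_tendsto_neg_mult_at_bot[OF tendsto_const _ filterlim_ident]) simp
    show "((\<lambda>t. vsetdist (x t) (ellipsoid n P 1)) \<longlongrightarrow> 0) at_top"
    proof (rule tendsto_sandwich[OF _ _ tendsto_const lim])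
      show "\<forall>\<^sub>F t in at_top. 0 \<le> vsetdist (x t) (ellipsoid n P 1)"
        using eventually_ge_at_top[of 0] by eventually_elim (rule vsetdist_ellipsoid_le(1)[OF P xc])
      show "\<forall>\<^sub>F t in at_top. vsetdist (x t) (ellipsoid n P 1) \<le> C * exp (- k * t)"
        using eventually_ge_at_top[of 0] by eventually_elim (rule bound)
    qed
  qed
  ultimately show "(\<exists>x. trajectory n B (\<lambda>t. (- k) \<cdot>\<^sub>v (H *\<^sub>v x t)) w x \<and> x 0 = x0) \<and>
      (\<forall>x. trajectory n B (\<lambda>t. (- k) \<cdot>\<^sub>v (H *\<^sub>v x t)) w x \<and> x 0 = x0 \<longrightarrow>
         (\<forall>t\<ge>0. (- k) \<cdot>\<^sub>v (H *\<^sub>v x t) \<in> ellipsoid m Ru 1) \<and>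
         ((\<lambda>t. vsetdist (x t) (ellipsoid n P 1)) \<longlongrightarrow> 0) at_top)"
    by blast
qed

thm_deps theorem3

end
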